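(* Group Linear Fractional Invariance (GLFI) is preserved by GShap, but not by Baseline Shapley (BShap) or Integrated Gradients (IG). That is: (1) For every $m\ge 1$, every group structure $B=\{B_1,\dots,B_l\}$ on $\{1,\dots,m\}$, every group $B_i$, every invertible linear fractional transformation $\mathbf p$ on $B_i$, all $\overline{\mathbf x},\mathbf x'\in\mathbb{R}^m$, and every $f\in\mathcal F$, $$\mathrm{GS}_{B_i}(\overline{\mathbf x},\mathbf x',f)=\mathrm{GS}_{B_i}\bigl(\mathbf p(\overline{\mathbf x}),\mathbf p(\mathbf x'),f\circ\mathbf p^{-1}\bigr).$$ (2) The corresponding statement for BShap is false: it is not the case that for every group structure $B$, every group $B_i$, every invertible linear fractional transformation $\mathbf p$ on $B_i$, all $\overline{\mathbf x},\mathbf x'$ and every $f\in\mathcal F$, $$\mathrm{BS}_{B_i}(\overline{\mathbf x},\mathbf x',f)=\mathrm{BS}_{B_i}\bigl(\mathbf p(\overline{\mathbf x}),\mathbf p(\mathbf x'),f\circ\mathbf p^{-1}\bigr).$$ (3) The corresponding statement for IG is false: it is not the case that for every group structure $B$, every group $B_i$, every invertible linear fractional transformation $\mathbf p$ on $B_i$, all $\overline{\mathbf x},\mathbf x'$ and every $f\in\mathcal F$, $$\mathrm{IG}_{B_i}(\overline{\mathbf x},\mathbf x',f)=\mathrm{IG}_{B_i}\bigl(\mathbf p(\overline{\mathbf x}),\mathbf p(\mathbf x'),f\circ\mathbf p^{-1}\bigr).$$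
   Context: $\mathcal F$ is a class of functions $f:\mathbb{R}^m\to\mathbb{R}$, assumed differentiable almost everywhere. A group structure on $M=\{1,\dots,m\}$ is a partition $B=\{B_1,\dots,B_l\}$ of $M$ into pairwise disjoint nonempty sets with union $M$; put $L=\{1,\dots,l\}$. For a group $B_i$ write $\mathbf x=(\mathbf x_{B_i},\mathbf x_\neg)$, where $\mathbf x_\neg$ collects the coordinates outside $B_i$. Linear fractional transformation on $B_i$: for real $|B_i|\times|B_i|$ matrices $\mathbf A,\mathbf B$ and vectors $\mathbf c,\mathbf d\in\mathbb{R}^{|B_i|}$, $$\mathbf p(\mathbf x)=\Bigl(\frac{\mathbf A\mathbf x_{B_i}+\mathbf c}{\mathbf B\mathbf x_{B_i}+\mathbf d},\ \mathbf x_\neg\Bigr),$$ where the division of vectors is entrywise. A method $\mathcal A$ (assigning group attributions $\mathcal A_{B_i}(\overline{\mathbf x},\mathbf x',f)$) preserves GLFI if for any group $B_i$ and any invertible transformation $\mathbf p$ of this form, $\mathcal A_{B_i}(\overline{\mathbf x},\mathbf x',f)=\mathcal A_{B_i}(\mathbf p(\overline{\mathbf x}),\mathbf p(\mathbf x'),f\circ\mathbf p^{-1})$. For $S\subseteq M$, $v(\overline{\mathbf x},\mathbf x',f;S)=f(\overline{\mathbf x}_S;\mathbf x'_{M\setminus S})$ is the value of $f$ at the point whose $k$-th coordinate is $\overline x_k$ if $k\in S$ and $x'_k$ otherwise. For $T\subseteq L$, $v_B(\overline{\mathbf x},\mathbf x',f;T)=v(\overline{\mathbf x},\mathbf x',f;\bigcup_{k\in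 T}B_k)$. GShap: $\displaystyle \mathrm{GS}_{B_i}(\overline{\mathbf x},\mathbf x',f)=\sum_{T\subseteq L\setminus\{i\}}\frac{|T|!\,(l-|T|-1)!}{l!}\bigl(v_B(\overline{\mathbf x},\mathbf x',f;T\cup\{i\})-v_B(\overline{\mathbf x},\mathbf x',f;T)\bigr).$ BShap: $\displaystyle \mathrm{BS}_j(\overline{\mathbf x},\mathbf x',f)=\sum_{S\subseteq M\setminus\{j\}}\frac{|S|!\,(m-|S|-1)!}{m!}\bigl(v(\overline{\mathbf x},\mathbf x',f;S\cup\{j\})-v(\overline{\mathbf x},\mathbf x',f;S)\bigr)$ and $\mathrm{BS}_{B_i}=\sum_{j\in B_i}\mathrm{BS}_j$. IG: $\displaystyle \mathrm{IG}_j(\overline{\mathbf x},\mathbf x',f)=(\overline x_j-x'_j)\int_0^1\frac{\partial f}{\partial x_j}\bigl(\mathbf x'+t(\overline{\mathbf x}-\mathbf x')\bigr)dt$ and $\mathrm{IG}_{B_i}=\sum_{j\in B_i}\mathrm{IG}_j$. *)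

theory Defs
  imports "HOL-Analysis.Analysis"
begin

text \<open>
  Points of \<open>\<real>\<^sup>m\<close> are functions on the index set \<open>{1..m}\<close>, extended by \<open>undefined\<close>, so
  that the dimension \<open>m\<close> can be quantified inside formulas (both under \<open>\<forall>\<close> and under
  \<open>\<not> \<forall>\<close>).
\<close>

type_synonym vec = "nat \<Rightarrow> real"

definition Rn :: "nat \<Rightarrow> vec set" where
  "Rn m = ({1..m} \<rightarrow>\<^sub>E (UNIV :: real set))"

definition norm_diff :: "nat \<Rightarrow> vec \<Rightarrow> vec \<Rightarrow> real" where
  "norm_diff m y x = L2_set (\<lambda>j. y j - x j) {1..m}"

text \<open>Total (Frechet) differentiability at a point, with gradient \<open>g\<close>.\<close>

definition differentiable_at_Rn :: "nat \<Rightarrow> (vec \<Rightarrow> real) \<Rightarrow> vec \<Rightarrow> bool" where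
  "differentiable_at_Rn m f x \<longleftrightarrow>
     (\<exists>g :: vec. \<forall>e>0. \<exists>\<delta>>0. \<forall>y\<in>Rn m. norm_diff m y x < \<delta> \<longrightarrow>
        \<bar>f y - f x - (\<Sum>j=1..m. g j * (y j - x j))\<bar> \<le> e * norm_diff m y x)"

text \<open>
  The class \<open>\<F>\<close>: all functions on \<open>\<real>\<^sup>m\<close> that are differentiable Lebesgue-almost everywhere.
  The values of \<open>f\<close> outside \<^term>\<open>Rn m\<close> are irrelevant.
\<close>

definition class_F :: "nat \<Rightarrow> (vec \<Rightarrow> real) set" where
  "class_F m = {f. AE x in PiM {1..m} (\<lambda>_. lborel :: real measure). differentiable_at_Rn m f x}"

definition group_structure :: "nat \<Rightarrow> nat \<Rightarrow> (nat \<Rightarrow> nat set) \<Rightarrow> bool" where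
  "group_structure m l B \<longleftrightarrow> inj_on B {1..l} \<and> partition_on {1..m} (B ` {1..l})"


text \<open>
  A linear fractional transformation on a group \<open>G\<close> has numerator matrix \<open>A\<close> and vector \<open>c\<close>,
  denominator matrix \<open>D\<close> and vector \<open>d\<close>; only the entries indexed by \<open>G\<close> matter. It is a
  partial map, defined where no denominator vanishes, and invertible means injective on
  that domain; its inverse is defined on its image.
\<close>

definition lin_frac ::
  "nat set \<Rightarrow> (nat \<Rightarrow> nat \<Rightarrow> real) \<Rightarrow> vec \<Rightarrow> (nat \<Rightarrow> nat \<Rightarrow> real) \<Rightarrow> vec \<Rightarrow> vec \<Rightarrow> vec" where
  "lin_frac G A c D d x =
     (\<lambda>k. if k \<in> G then ((\<Sum>j\<in>G. A k j * x j) + c k) / ((\<Sum>j\<in>G. D k j * x j) + d k)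
          else x k)"

definition lin_frac_dom ::
  "nat \<Rightarrow> nat set \<Rightarrow> (nat \<Rightarrow> nat \<Rightarrow> real) \<Rightarrow> vec \<Rightarrow> vec set" where
  "lin_frac_dom m G D d = {x \<in> Rn m. \<forall>k\<in>G. (\<Sum>j\<in>G. D k j * x j) + d k \<noteq> 0}"


definition v :: "vec \<Rightarrow> vec \<Rightarrow> (vec \<Rightarrow> real) \<Rightarrow> nat set \<Rightarrow> real" where
  "v xb x' f S = f (override_on x' xb S)"

definition v_group ::
  "(nat \<Rightarrow> nat set) \<Rightarrow> vec \<Rightarrow> vec \<Rightarrow> (vec \<Rightarrow> real) \<Rightarrow> nat set \<Rightarrow> real" where
  "v_group B xb x' f T = v xb x' f (\<Union>k\<in>T. B k)"

text \<open>
  A group attribution takes the dimension \<open>m\<close>, the number of groups \<open>l\<close>, the groups \<open>B\<close>, the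
  index \<open>i\<close> of the group to be scored, the explicand, the baseline and the function.
\<close>

type_synonym attribution =
  "nat \<Rightarrow> nat \<Rightarrow> (nat \<Rightarrow> nat set) \<Rightarrow> nat \<Rightarrow> vec \<Rightarrow> vec \<Rightarrow> (vec \<Rightarrow> real) \<Rightarrow> real"

definition GShap :: attribution where
  "GShap m l B i xb x' f =
     (\<Sum>T\<in>Pow ({1..l} - {i}). fact (card T) * fact (l - card T - 1) / fact l *
        (v_group B xb x' f (T \<union> {i}) - v_group B xb x' f T))"

definition BShap :: "nat \<Rightarrow> nat \<Rightarrow> vec \<Rightarrow> vec \<Rightarrow> (vec \<Rightarrow> real) \<Rightarrow> real" where
  "BShap m j xb x' f =
     (\<Sum>S\<in>Pow ({1..m} - {j}). fact (card S) * fact (m - card S - 1) / fact m *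
        (v xb x' f (S \<union> {j}) - v xb x' f S))"

definition BShap_group :: attribution where
  "BShap_group m l B i xb x' f = (\<Sum>j\<in>B i. BShap m j xb x' f)"

definition partial_deriv :: "nat \<Rightarrow> (vec \<Rightarrow> real) \<Rightarrow> vec \<Rightarrow> real" where
  "partial_deriv j f x = deriv (\<lambda>s. f (x(j := s))) (x j)"

definition seg :: "nat \<Rightarrow> vec \<Rightarrow> vec \<Rightarrow> real \<Rightarrow> vec" where
  "seg m xb x' t = (\<lambda>k\<in>{1..m}. x' k + t * (xb k - x' k))"

definition IG :: "nat \<Rightarrow> nat \<Rightarrow> vec \<Rightarrow> vec \<Rightarrow> (vec \<Rightarrow> real) \<Rightarrow> real" where
  "IG m j xb x' f =
     (xb j - x' j) * integral {0..1} (\<lambda>t. partial_deriv j f (seg m xb x' t))"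

definition IG_group :: attribution where
  "IG_group m l B i xb x' f = (\<Sum>j\<in>B i. IG m j xb x' f)"


text \<open>
  The function \<open>f \<circ> p\<^sup>-\<^sup>1\<close> exists only on the image of \<open>p\<close>, so an attribution of it can
  be meaningless. A condition of the following type says that the attribution is meaningful
  for a function whose true domain is the set \<open>U\<close>.
\<close>

type_synonym well_definedness =
  "nat \<Rightarrow> nat \<Rightarrow> (nat \<Rightarrow> nat set) \<Rightarrow> nat \<Rightarrow> vec set \<Rightarrow> vec \<Rightarrow> vec \<Rightarrow> (vec \<Rightarrow> real) \<Rightarrow> bool"

definition BShap_wd :: well_definedness where
  "BShap_wd m l B i U xb x' f \<longleftrightarrow> (\<forall>S\<subseteq>{1..m}. override_on x' xb S \<in> U)"

text \<open>
  The sets \<open>U\<close> used below are \<^term>\<open>Rn m\<close> and images of invertible linear fractional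
  transformations. Both are open in \<^term>\<open>Rn m\<close>, the latter by invariance of domain, so
  derivatives at points of \<open>U\<close> depend only on the values on \<open>U\<close>.
\<close>

definition IG_wd :: well_definedness where
  "IG_wd m l B i U xb x' f \<longleftrightarrow>
     (\<forall>t\<in>{0..1}. seg m xb x' t \<in> U) \<and>
     (\<forall>j\<in>B i.
        (\<forall>t\<in>{0..1}. (\<lambda>s. f ((seg m xb x' t)(j := s)))
                       field_differentiable at (seg m xb x' t j)) \<and>
        (\<lambda>t. partial_deriv j f (seg m xb x' t)) absolutely_integrable_on {0..1})"

text \<open>
  Group linear fractional invariance of \<open>attr\<close>, tested on those instances in which both sides
  are meaningful according to \<open>wd\<close>. A stronger \<open>wd\<close> gives a weaker property. For GShap the
  constantly true condition is appropriate: its sums evaluate \<open>f \<circ> p\<^sup>-\<^sup>1\<close> only at images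
  under \<open>p\<close> of points in the domain of \<open>p\<close>.
\<close>

definition preserves_GLFI :: "well_definedness \<Rightarrow> attribution \<Rightarrow> bool" where
  "preserves_GLFI wd attr \<longleftrightarrow>
     (\<forall>m l B i A c D d xb x' f.
        let p = lin_frac (B i) A c D d;
            dom_p = lin_frac_dom m (B i) D d;
            q = inv_into dom_p p
        in m \<ge> 1 \<longrightarrow> group_structure m l B \<longrightarrow> i \<in> {1..l} \<longrightarrow>
           inj_on p dom_p \<longrightarrow> xb \<in> dom_p \<longrightarrow> x' \<in> dom_p \<longrightarrow> f \<in> class_F m \<longrightarrow>
           wd m l B i (Rn m) xb x' f \<longrightarrow>
           wd m l B i (p ` dom_p) (p xb) (p x') (f \<circ> q) \<longrightarrow>
           attr m l B i xb x' f = attr m l B i (p xb) (p x') (f \<circ> q))"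

end

theory Submission
  imports Defs
begin

text \<open>
  A transformation acting inside a single group commutes with replacing whole groups of the
  baseline by those of the explicand, so GShap compares the same values of \<open>f\<close> on both sides.
  BShap and IG also use points at which the group is replaced only partially, and a
  transformation mixing coordinates inside the group moves these. With groups \<open>{1,2}\<close>, \<open>{3}\<close>,
  the function \<open>x\<^sub>1 x\<^sub>3\<close> and the map \<open>(x\<^sub>1, x\<^sub>2, x\<^sub>3) \<mapsto> (x\<^sub>1 / x\<^sub>2, x\<^sub>2, x\<^sub>3)\<close>, the transformed
  function is \<open>y\<^sub>1 y\<^sub>2 y\<^sub>3\<close>. Moving from \<open>(0, 1, 0)\<close> to \<open>(1, 2, 1)\<close>, both methods give the
  first group \<open>1/2\<close> before the transformation and \<open>7/12\<close> after it.
\<close>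

section \<open>Group Shapley values\<close>

text \<open>The linear forms read only coordinates in \<open>G\<close>. If \<open>S\<close> contains
  or avoids \<open>G\<close>, these all come from a single point, and membership of \<open>k\<close>
  in \<open>S\<close> tells which one.\<close>

lemma sum_override_on:
  fixes x y :: vec
  assumes "G \<subseteq> S \<or> G \<inter> S = {}" "k \<in> G"
  shows "(\<Sum>j\<in>G. a j * override_on x y S j) =
         (if k \<in> S then \<Sum>j\<in>G. a j * y j else \<Sum>j\<in>G. a j * x j)"
  using assms by (auto intro!: sum.cong simp: override_on_def)

lemma lin_frac_override_on:
  assumes "G \<subseteq> S \<or> G \<inter> S = {}"
  shows "lin_frac G A c D d (override_on x' xb S) =
         override_on (lin_frac G A c D d x') (lin_frac G A c D d xb) S"
proof
  fix k
  show "lin_frac G A c D d (override_on x' xb S) k =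
        override_on (lin_frac G A c D d x') (lin_frac G A c D d xb) S k"
    using sum_override_on[OF assms, of k]
    by (cases "k \<in> G"; cases "k \<in> S") (simp_all add: lin_frac_def)
qed

lemma override_on_in_Rn: "x \<in> Rn m \<Longrightarrow> y \<in> Rn m \<Longrightarrow> override_on x y S \<in> Rn m"
  by (auto simp: override_on_def Rn_def PiE_iff extensional_def)

lemma override_on_in_lin_frac_dom:
  assumes "G \<subseteq> S \<or> G \<inter> S = {}"
    and "x' \<in> lin_frac_dom m G D d" "xb \<in> lin_frac_dom m G D d"
  shows "override_on x' xb S \<in> lin_frac_dom m G D d"
  using assms(2,3) sum_override_on[OF assms(1)]
  by (simp add: lin_frac_dom_def override_on_in_Rn)

text \<open>This supplies the contain-or-avoid condition for unions of whole groups. Injectivity of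
  \<open>B\<close> turns distinct indices into distinct blocks, which are disjoint in a
  partition.\<close>

lemma group_structure_Union:
  assumes "group_structure m l B" "i \<in> {1..l}" "T \<subseteq> {1..l}"
  shows "B i \<subseteq> (\<Union>k\<in>T. B k) \<or> B i \<inter> (\<Union>k\<in>T. B k) = {}"
proof (cases "i \<in> T")
  case False
  have "B i \<inter> B k = {}" if "k \<in> T" for k
  proof -
    have "k \<in> {1..l}" "k \<noteq> i" using that False assms(3) by auto
    with assms(1,2) show ?thesis
      unfolding group_structure_def partition_on_def
      by (metis disjointD imageI inj_on_eq_iff)
  qed
  then show ?thesis by blast
qed blast

lemma GShap_preserves_GLFI: "preserves_GLFI (\<lambda>m l B i U xb x' f. True) GShap"
proof -
  have "GShap m l B i xb x' f = GShap m l B i (p xb) (p x') (f \<circ> inv_into dom_p p)"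
    if B: "group_structure m l B" and i: "i \<in> {1..l}" and p: "p = lin_frac (B i) A c D d"
      and dom: "dom_p = lin_frac_dom m (B i) D d" and inj: "inj_on p dom_p"
      and xb: "xb \<in> dom_p" and x': "x' \<in> dom_p"
    for m l B i p dom_p A c D d xb x' f
  proof -
    have val: "v_group B (p xb) (p x') (f \<circ> inv_into dom_p p) T = v_group B xb x' f T"
      if "T \<subseteq> {1..l}" for T
    proof -
      note S = group_structure_Union[OF B i that]
      \<comment> \<open>The mixed point lies in \<open>dom_p\<close>, so \<open>inv_into\<close>
        cancels \<open>p\<close> there; commuting \<open>p\<close> with the replacement then leaves
        the original argument of \<open>f\<close>.\<close>
      have "override_on x' xb (\<Union>k\<in>T. B k) \<in> dom_p"
        using override_on_in_lin_frac_dom[OF S] xb x' dom by simp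
      then show ?thesis
        using lin_frac_override_on[OF S] inj
        by (simp add: v_group_def v_def p flip: lin_frac_override_on[OF S])
    qed
    show ?thesis
      unfolding GShap_def using i by (intro sum.cong refl) (subst (1 2) val; auto)
  qed
  then show ?thesis
    unfolding preserves_GLFI_def Let_def by blast
qed

section \<open>The counterexample\<close>

definition cex_groups :: "nat \<Rightarrow> nat set" where
  "cex_groups k = (if k = 1 then {1, 2} else {3})"

text \<open>At \<open>x 2 = 0\<close> the quotient is 0 whatever \<open>x 1\<close> is, so
  injectivity is lost there; \<open>cex_dom\<close> excludes these points.\<close>

definition cex_map :: "vec \<Rightarrow> vec" where
  "cex_map x = x(1 := x 1 / x 2)"

definition cex_dom :: "vec set" where
  "cex_dom = {x \<in> Rn 3. x 2 \<noteq> 0}"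

definition cex_explicand :: vec where
  "cex_explicand = (\<lambda>k\<in>{1..3}. if k = 2 then 2 else 1)"

definition cex_baseline :: vec where
  "cex_baseline = (\<lambda>k\<in>{1..3}. if k = 2 then 1 else 0)"

definition cex_fun :: "vec \<Rightarrow> real" where
  "cex_fun x = x 1 * x 3"

abbreviation cex_fun' :: "vec \<Rightarrow> real" where
  "cex_fun' \<equiv> cex_fun \<circ> inv_into cex_dom cex_map"

lemma group_structure_cex: "group_structure 3 2 cex_groups"
proof -
  have "{1..2::nat} = {1, 2}" "{1..3::nat} = {1, 2, 3}" by auto
  then show ?thesis
    by (auto simp: group_structure_def cex_groups_def inj_on_def partition_on_def disjoint_def)
qed

text \<open>The numerators are \<open>x 1\<close> and \<open>x 2\<close>. The denominator matrix has
  its only nonzero entry at (1,2), giving \<open>x 2\<close> in the first row; the constant vector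
  gives 1 in the second.\<close>

lemma cex_map_conv_lin_frac:
  "lin_frac {1, 2} (\<lambda>k j. of_bool (k = j)) (\<lambda>_. 0)
     (\<lambda>k j. of_bool (k = 1 \<and> j = 2)) (\<lambda>k. of_bool (k = 2)) = cex_map"
proof (intro ext)
  fix x and k :: nat
  consider "k = 1" | "k = 2" | "k \<notin> {1, 2}" by blast
  then show "lin_frac {1, 2} (\<lambda>k j. of_bool (k = j)) (\<lambda>_. 0)
     (\<lambda>k j. of_bool (k = 1 \<and> j = 2)) (\<lambda>k. of_bool (k = 2)) x k = cex_map x k"
    by cases (simp_all add: lin_frac_def cex_map_def)
qed

lemma cex_dom_conv_lin_frac_dom:
  "lin_frac_dom 3 {1, 2} (\<lambda>k j. of_bool (k = 1 \<and> j = 2)) (\<lambda>k. of_bool (k = 2)) = cex_dom"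
  by (auto simp: lin_frac_dom_def cex_dom_def)

lemma inj_on_cex_map: "inj_on cex_map cex_dom"
proof (rule inj_onI)
  fix x y assume *: "x \<in> cex_dom" "y \<in> cex_dom" "cex_map x = cex_map y"
  have eq: "cex_map x k = cex_map y k" for k using * by simp
  have "x k = y k" for k
    using eq[of k] eq[of 2] * by (auto simp: cex_map_def cex_dom_def split: if_splits)
  then show "x = y" by auto
qed

lemma Rn_fun_upd [simp]: "x \<in> Rn m \<Longrightarrow> j \<in> {1..m} \<Longrightarrow> x(j := s) \<in> Rn m"
  by (auto simp: Rn_def PiE_iff extensional_def)

text \<open>Coordinate 2 is fixed by the map, so the inverse multiplies coordinate 1 by it.\<close>

lemma cex_map_inverse:
  assumes "y \<in> Rn 3" "y 2 \<noteq> 0"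
  shows "y \<in> cex_map ` cex_dom" and "cex_fun' y = y 1 * y 2 * y 3"
proof -
  define x where "x = y(1 := y 1 * y 2)"
  have x: "x \<in> cex_dom" "cex_map x = y"
    using assms by (auto simp: x_def cex_dom_def cex_map_def)
  then show "y \<in> cex_map ` cex_dom" by blast
  have "inv_into cex_dom cex_map y = x"
    using x inj_on_cex_map by (metis inv_into_f_f)
  then show "cex_fun' y = y 1 * y 2 * y 3"
    by (simp add: x_def cex_fun_def)
qed

lemma cex_fun_in_class_F: "cex_fun \<in> class_F 3"
proof -
  have "differentiable_at_Rn 3 cex_fun x" for x
    unfolding differentiable_at_Rn_def
  \<comment> \<open>The witness is the gradient of \<open>x 1 * x 3\<close>. The remainder is
    exactly \<open>(y 1 - x 1) * (y 3 - x 3)\<close>, at most the squared distance, so \<delta> can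
    be taken equal to \<open>e\<close>.\<close>
  proof (intro exI[of _ "\<lambda>j. if j = 1 then x 3 else if j = 3 then x 1 else 0"] allI impI)
    fix e :: real assume "e > 0"
    let ?g = "\<lambda>j::nat. if j = 1 then x 3 else if j = 3 then x 1 else 0"
    have "\<bar>cex_fun y - cex_fun x - (\<Sum>j=1..3. ?g j * (y j - x j))\<bar> \<le> e * norm_diff 3 y x"
      if "norm_diff 3 y x < e" for y
    proof -
      have coord: "\<bar>y j - x j\<bar> \<le> norm_diff 3 y x" if "j \<in> {1..3}" for j
        using member_le_L2_set[OF _ that, of "\<lambda>j. \<bar>y j - x j\<bar>"]
        by (simp add: norm_diff_def L2_set_def)
      have "cex_fun y - cex_fun x - (\<Sum>j=1..3. ?g j * (y j - x j)) =
            (y 1 - x 1) * (y 3 - x 3)"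
        by (simp add: cex_fun_def eval_nat_numeral) (simp add: algebra_simps)
      also have "\<bar>\<dots>\<bar> \<le> norm_diff 3 y x * norm_diff 3 y x"
        unfolding abs_mult by (intro mult_mono coord) (auto simp: norm_diff_def)
      also have "\<dots> \<le> e * norm_diff 3 y x"
        using that by (intro mult_right_mono) (auto simp: norm_diff_def)
      finally show ?thesis .
    qed
    with \<open>e > 0\<close> show "\<exists>\<delta>>0. \<forall>y\<in>Rn 3. norm_diff 3 y x < \<delta> \<longrightarrow>
      \<bar>cex_fun y - cex_fun x - (\<Sum>j=1..3. ?g j * (y j - x j))\<bar> \<le> e * norm_diff 3 y x"
      by blast
  qed
  then show ?thesis by (simp add: class_F_def)
qed

lemma cex_points:
  "cex_explicand \<in> cex_dom" "cex_baseline \<in> cex_dom"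
  "cex_map cex_explicand = cex_explicand(1 := 1 / 2)" "cex_map cex_baseline = cex_baseline"
  by (auto simp: cex_dom_def cex_explicand_def cex_baseline_def Rn_def cex_map_def)

text \<open>Both negative results use the same instance, so each reduces to two well-definedness
  checks and a comparison of two numbers.\<close>

lemma not_preserves_GLFI_cexI:
  assumes "wd 3 2 cex_groups 1 (Rn 3) cex_explicand cex_baseline cex_fun"
    and "wd 3 2 cex_groups 1 (cex_map ` cex_dom) (cex_explicand(1 := 1 / 2)) cex_baseline cex_fun'"
    and "attr 3 2 cex_groups 1 cex_explicand cex_baseline cex_fun \<noteq>
         attr 3 2 cex_groups 1 (cex_explicand(1 := 1 / 2)) cex_baseline cex_fun'"
  shows "\<not> preserves_GLFI wd attr"
proof
  assume "preserves_GLFI wd attr"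
  note inst = this[unfolded preserves_GLFI_def Let_def, rule_format,
      of 3 2 cex_groups 1 "\<lambda>k j. of_bool (k = j)" "\<lambda>_. 0"
         "\<lambda>k j. of_bool (k = 1 \<and> j = 2)" "\<lambda>k. of_bool (k = 2)"
         cex_explicand cex_baseline cex_fun]
  have "cex_groups 1 = {1, 2}" by (simp add: cex_groups_def)
  note inst = inst[unfolded this cex_map_conv_lin_frac cex_dom_conv_lin_frac_dom cex_points(3,4)]
  show False
    using assms(3) inst[OF _ group_structure_cex _ inj_on_cex_map cex_points(1,2)
      cex_fun_in_class_F assms(1,2)]
    by simp
qed

section \<open>Baseline Shapley values in the counterexample\<close>

lemma cex_points_Rn: "cex_explicand \<in> Rn 3" "cex_baseline \<in> Rn 3"
  using cex_points by (auto simp: cex_dom_def)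

text \<open>Coordinate 2 of any mixture is 1 or 2, so every point visited by BShap lies in the image
  of \<open>cex_map\<close>.\<close>

lemma cex_override_on:
  "override_on cex_baseline (cex_explicand(1 := a)) S \<in> Rn 3"
  "override_on cex_baseline (cex_explicand(1 := a)) S 2 \<noteq> 0"
  by (intro override_on_in_Rn Rn_fun_upd cex_points_Rn)
     (auto simp: override_on_def cex_explicand_def cex_baseline_def)

text \<open>In dimension 3 the Shapley weights are 1/3, 1/6, 1/3 for coalitions of size 0, 1,
  2.\<close>

lemma BShap_3:
  "BShap 3 1 xb x' f + BShap 3 2 xb x' f =
   (v xb x' f {1} - v xb x' f {}) / 3 + (v xb x' f {1, 2} - v xb x' f {2}) / 6 +
   (v xb x' f {1, 3} - v xb x' f {3}) / 6 + (v xb x' f {1, 2, 3} - v xb x' f {2, 3}) / 3 +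
   (v xb x' f {2} - v xb x' f {}) / 3 + (v xb x' f {1, 2} - v xb x' f {1}) / 6 +
   (v xb x' f {2, 3} - v xb x' f {3}) / 6 + (v xb x' f {1, 2, 3} - v xb x' f {1, 3}) / 3"
proof -
  have *: "{1..3} - {1} = {2, 3::nat}" "{1..3} - {2} = {1, 3::nat}" by auto
  have "Pow {a, b} = {{}, {a}, {b}, {a, b}}" for a b :: nat by auto
  then have **: "(\<Sum>S\<in>Pow {a, b}. g S) = g {} + g {a} + g {b} + g {a, b}"
    if "a \<noteq> b" for a b and g :: "nat set \<Rightarrow> real"
    using that by (simp add: doubleton_eq_iff add.assoc)
  have "fact 3 = (6::real)" by (simp add: fact_numeral)
  then show ?thesis
    by (simp add: BShap_def * ** insert_commute field_simps del: One_nat_def)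
qed

lemma BShap_not_preserves_GLFI: "\<not> preserves_GLFI BShap_wd BShap_group"
proof (rule not_preserves_GLFI_cexI)
  show "BShap_wd 3 2 cex_groups 1 (Rn 3) cex_explicand cex_baseline cex_fun"
    by (auto simp: BShap_wd_def intro: override_on_in_Rn cex_points_Rn)
  show "BShap_wd 3 2 cex_groups 1 (cex_map ` cex_dom) (cex_explicand(1 := 1 / 2))
    cex_baseline cex_fun'"
    unfolding BShap_wd_def by (intro allI impI cex_map_inverse(1) cex_override_on)
  have "BShap_group 3 2 cex_groups 1 cex_explicand cex_baseline cex_fun = 1 / 2"
    by (simp add: BShap_group_def cex_groups_def BShap_3 v_def cex_fun_def override_on_def
        cex_explicand_def cex_baseline_def del: One_nat_def)
  moreover have "v (cex_explicand(1 := 1 / 2)) cex_baseline cex_fun' S =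
      (\<lambda>y. y 1 * y 2 * y 3) (override_on cex_baseline (cex_explicand(1 := 1 / 2)) S)" for S
    unfolding v_def by (rule cex_map_inverse(2)[OF cex_override_on])
  then have "BShap_group 3 2 cex_groups 1 (cex_explicand(1 := 1 / 2)) cex_baseline cex_fun'
      = 7 / 12"
    \<comment> \<open>Keeping the composition folded lets the preceding formula for \<open>v\<close>
      replace \<open>cex_fun'\<close> by the product. The surviving terms are 1/12 + 1/3 +
      1/6.\<close>
    by (simp add: BShap_group_def cex_groups_def BShap_3 override_on_def
        cex_explicand_def cex_baseline_def del: comp_apply One_nat_def)
  ultimately show "BShap_group 3 2 cex_groups 1 cex_explicand cex_baseline cex_fun \<noteq>
      BShap_group 3 2 cex_groups 1 (cex_explicand(1 := 1 / 2)) cex_baseline cex_fun'"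
    by simp
qed

section \<open>Integrated gradients in the counterexample\<close>

lemma seg_Rn [simp]: "seg m xb x' t \<in> Rn m"
  by (simp add: seg_def Rn_def)

text \<open>A continuous \<open>g j\<close> is absolutely integrable and equals the partial
  derivative at every \<open>t\<close> in the interval, so the exceptional set is empty.\<close>

lemma IG_wdI:
  assumes "\<And>t. t \<in> {0..1} \<Longrightarrow> seg m xb x' t \<in> U"
    and der: "\<And>j t. j \<in> B i \<Longrightarrow> t \<in> {0..1} \<Longrightarrow>
      ((\<lambda>s. f ((seg m xb x' t)(j := s))) has_field_derivative g j t) (at (seg m xb x' t j))"
    and cont: "\<And>j. j \<in> B i \<Longrightarrow> continuous_on {0..1} (g j)"
  shows "IG_wd m l B i U xb x' f"
  unfolding IG_wd_def
proof (intro conjI ballI)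
  fix j assume j: "j \<in> B i"
  have "g j absolutely_integrable_on {0..1}"
    using cont[OF j] by (rule absolutely_integrable_continuous_real)
  then show "(\<lambda>t. partial_deriv j f (seg m xb x' t)) absolutely_integrable_on {0..1}"
    by (rule absolutely_integrable_spike[OF _ negligible_empty])
       (simp add: partial_deriv_def DERIV_imp_deriv[OF der[OF j]])
qed (use assms in \<open>auto simp: field_differentiable_def\<close>)

lemma IG_eqI:
  assumes "\<And>t. t \<in> {0..1} \<Longrightarrow>
      ((\<lambda>s. f ((seg m xb x' t)(j := s))) has_field_derivative g t) (at (seg m xb x' t j))"
    and "(g has_integral I) {0..1}"
  shows "IG m j xb x' f = (xb j - x' j) * I"
proof -
  have "integral {0..1} (\<lambda>t. partial_deriv j f (seg m xb x' t)) = integral {0..1} g"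
    by (rule integral_cong) (simp add: partial_deriv_def DERIV_imp_deriv[OF assms(1)])
  with assms(2) show ?thesis by (simp add: IG_def integral_unique)
qed

lemma cex_points_nth:
  "cex_explicand 1 = 1" "cex_explicand 2 = 2" "cex_baseline 1 = 0" "cex_baseline 2 = 1"
  by (auto simp: cex_explicand_def cex_baseline_def)

lemma cex_seg:
  "seg 3 (cex_explicand(1 := a)) cex_baseline t 1 = t * a"
  "seg 3 (cex_explicand(1 := a)) cex_baseline t 2 = 1 + t"
  "seg 3 (cex_explicand(1 := a)) cex_baseline t 3 = t"
  by (auto simp: seg_def cex_explicand_def cex_baseline_def)

lemma IG_not_preserves_GLFI: "\<not> preserves_GLFI IG_wd IG_group"
proof -
  \<comment> \<open>In this form \<open>cex_seg\<close> covers both segments, with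
    \<open>a = 1\<close> and \<open>a = 1 / 2\<close>.\<close>
  have xb: "cex_explicand = cex_explicand(1 := 1)"
    by (auto simp: cex_explicand_def)
  define \<gamma> where "\<gamma> = seg 3 cex_explicand cex_baseline"
  define \<gamma>' where "\<gamma>' = seg 3 (cex_explicand(1 := 1 / 2)) cex_baseline"
  \<comment> \<open>The functions \<open>g\<close> and \<open>g'\<close> are the partial derivatives
    of \<open>x 1 * x 3\<close> and \<open>y 1 * y 2 * y 3\<close> along the two segments.\<close>
  define g where "g = (\<lambda>(j::nat) t::real. if j = 1 then t else 0)"
  define g' where "g' = (\<lambda>(j::nat) t::real. if j = 1 then (1 + t) * t else t / 2 * t)"
  have \<gamma>: "\<gamma> t 1 = t" "\<gamma> t 2 = 1 + t" "\<gamma> t 3 = t" for t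
    unfolding \<gamma>_def by (subst xb, subst cex_seg, simp)+
  have \<gamma>': "\<gamma>' t 1 = t / 2" "\<gamma>' t 2 = 1 + t" "\<gamma>' t 3 = t" for t
    unfolding \<gamma>'_def cex_seg by simp_all
  have der: "((\<lambda>s. cex_fun ((\<gamma> t)(j := s))) has_field_derivative g j t) (at (\<gamma> t j))"
    if "j \<in> cex_groups 1" for j t
  proof -
    have "j = 1 \<or> j = 2" using that by (auto simp: cex_groups_def)
    then show ?thesis
      by (auto simp: cex_fun_def g_def \<gamma>[simplified] intro!: derivative_eq_intros)
  qed
  have der': "((\<lambda>s. cex_fun' ((\<gamma>' t)(j := s))) has_field_derivative g' j t) (at (\<gamma>' t j))"
    if "j \<in> cex_groups 1" "t \<in> {0..1}" for j t
  proof -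
    have j: "j = 1 \<or> j = 2" using that by (auto simp: cex_groups_def)
    \<comment> \<open>The product formula for \<open>cex_fun'\<close> requires a nonzero second
      coordinate. When that coordinate varies, it is confined to an open half-line containing
      \<open>1 + t\<close>; coordinate 1 may vary freely.\<close>
    let ?U = "if j = 2 then {0<..} else UNIV :: real set"
    let ?h = "\<lambda>s. ((\<gamma>' t)(j := s)) 1 * ((\<gamma>' t)(j := s)) 2 * ((\<gamma>' t)(j := s)) 3"
    have "(?h has_field_derivative g' j t) (at (\<gamma>' t j))"
      using j by (auto simp: g'_def \<gamma>'[simplified] intro!: derivative_eq_intros)
    moreover have "open ?U" "\<gamma>' t j \<in> ?U"
      using \<open>t \<in> {0..1}\<close> \<gamma>'(2)[of t] by auto
    moreover have "?h s = cex_fun' ((\<gamma>' t)(j := s))" if "s \<in> ?U" for s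
    proof (rule cex_map_inverse(2)[symmetric])
      show "(\<gamma>' t)(j := s) \<in> Rn 3"
        using j by (auto simp: \<gamma>'_def)
      show "((\<gamma>' t)(j := s)) 2 \<noteq> 0"
        using j that \<open>t \<in> {0..1}\<close> \<gamma>'(2)[of t] by auto
    qed
    ultimately show ?thesis
      by (rule has_field_derivative_transform_within_open)
  qed
  have int: "((\<lambda>t. t) has_integral 1 / 2) {0..1::real}"
    using ident_has_integral[of 0 1] by simp
  have "((\<lambda>t. t * t) has_integral 1 ^ 3 / 3 - 0 ^ 3 / 3) {0..1::real}"
    by (rule fundamental_theorem_of_calculus)
       (auto intro!: derivative_eq_intros simp: power2_eq_square
          simp flip: has_real_derivative_iff_has_vector_derivative)
  then have int2: "((\<lambda>t. t * t) has_integral 1 / 3) {0..1::real}"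
    by simp
  have ints: "(g 1 has_integral 1 / 2) {0..1}" "(g 2 has_integral 0) {0..1}"
    "(g' 1 has_integral 5 / 6) {0..1}" "(g' 2 has_integral 1 / 6) {0..1}"
    using int has_integral_add[OF int int2] has_integral_mult_right[OF int2, of "1 / 2"]
    by (simp_all add: g_def g'_def algebra_simps)
  have IG: "IG 3 j cex_explicand cex_baseline cex_fun =
      (cex_explicand j - cex_baseline j) * I"
    if "j \<in> cex_groups 1" "(g j has_integral I) {0..1}" for j I
    using der[OF that(1), unfolded \<gamma>_def] that(2) by (rule IG_eqI)
  have IG': "IG 3 j (cex_explicand(1 := 1 / 2)) cex_baseline cex_fun' =
      ((cex_explicand(1 := 1 / 2)) j - cex_baseline j) * I"
    if "j \<in> cex_groups 1" "(g' j has_integral I) {0..1}" for j I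
    using der'[OF that(1), unfolded \<gamma>'_def] that(2) by (rule IG_eqI)
  have groups: "1 \<in> cex_groups 1" "2 \<in> cex_groups 1"
    by (auto simp: cex_groups_def)
  show ?thesis
  proof (rule not_preserves_GLFI_cexI)
    show "IG_wd 3 2 cex_groups 1 (Rn 3) cex_explicand cex_baseline cex_fun"
    proof (rule IG_wdI[where g = g])
      show "continuous_on {0..1} (g j)" for j
        by (cases "j = 1") (auto simp: g_def)
    qed (use der in \<open>simp_all add: \<gamma>_def\<close>)
    show "IG_wd 3 2 cex_groups 1 (cex_map ` cex_dom) (cex_explicand(1 := 1 / 2))
      cex_baseline cex_fun'"
    proof (rule IG_wdI[where g = g'])
      show "seg 3 (cex_explicand(1 := 1 / 2)) cex_baseline t \<in> cex_map ` cex_dom"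
        if "t \<in> {0..1}" for t
        using that by (intro cex_map_inverse(1)) (auto simp: cex_seg[simplified])
      show "continuous_on {0..1} (g' j)" for j
        by (cases "j = 1") (auto simp: g'_def intro!: continuous_intros)
    qed (use der' in \<open>simp_all add: \<gamma>'_def\<close>)
    have "IG_group 3 2 cex_groups 1 cex_explicand cex_baseline cex_fun = 1 / 2"
      using IG[OF groups(1) ints(1)] IG[OF groups(2) ints(2)]
      by (simp add: IG_group_def cex_groups_def cex_points_nth del: One_nat_def)
    \<comment> \<open>The increments are 1/2 and 1, so the sum is (1/2)(5/6) + 1/6.\<close>
    moreover have "IG_group 3 2 cex_groups 1 (cex_explicand(1 := 1 / 2)) cex_baseline cex_fun'
        = 7 / 12"
      using IG'[OF groups(1) ints(3)] IG'[OF groups(2) ints(4)]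
      by (simp add: IG_group_def cex_groups_def cex_points_nth del: One_nat_def)
    ultimately show "IG_group 3 2 cex_groups 1 cex_explicand cex_baseline cex_fun \<noteq>
        IG_group 3 2 cex_groups 1 (cex_explicand(1 := 1 / 2)) cex_baseline cex_fun'"
      by simp
  qed
qed

theorem proposition4p9:
  shows "preserves_GLFI (\<lambda>m l B i U xb x' f. True) GShap
       \<and> \<not> preserves_GLFI BShap_wd BShap_group
       \<and> \<not> preserves_GLFI IG_wd IG_group"
  using GShap_preserves_GLFI BShap_not_preserves_GLFI IG_not_preserves_GLFI by blast

end
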